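(* Let $n,d\ge 1$ and $k\ge 2$, and let $f_1,f_2:\mathbb{S}_n\to\mathbb{C}^d$ be functions for which there is a fixed $\overline\sigma\in\mathbb{S}_n$ with $f_1(\sigma)=f_2(\overline\sigma\sigma)$ for every $\sigma\in\mathbb{S}_n$. Then the Multi-Orbit $k$-Spectra of $f_1$ and $f_2$ are identical: for every $G_{k-2}\in(\mathbb{S}_n)^{k-2}$ and every irreducible representation $\rho\in\mathrm{Irr}(\mathbb{S}_n)$, $$\hat{\mathcal S}^{(k)}_{f_1}(G_{k-2},\rho)=\hat{\mathcal S}^{(k)}_{f_2}(G_{k-2},\rho).$$
   Context: $\mathbb{S}_n$ is the symmetric group on $\{1,\dots,n\}$. $\mathrm{Irr}(\mathbb{S}_n)$ is the set of its irreducible representations in Young's orthogonal form (real orthogonal, in particular unitary, matrices), indexed by the partitions of $n$. The Fourier transform of $\phi:\mathbb{S}_n\to\mathbb{C}$ is $\hat\phi(\rho)=\frac{1}{|\mathbb{S}_n|}\sum_{g\in\mathbb{S}_n}\phi(g)\rho(g)$. Let $f:\mathbb{S}_n\to\mathbb{C}^d$ have scalar components $f^{[1]},\dots,f^{[d]}:\mathbb{S}_n\to\mathbb{C}$. For $G_{k-2}=(g_1,\dots,g_{k-2})\in(\mathbb{S}_n)^{k-2}$ (the empty list if $k=2$), $I_{k-1}=(i_1,\dots,i_{k-1})\in\{1,\dots,d\}^{k-1}$ and $\rho\in\mathrm{Irr}(\mathbb{S}_n)$ put $$\hat r^{(k)}_{I_{k-1}}(G_{k-2},\rho)=\frac{1}{|\mathbb{S}_n|}\sum_{\tilde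 g\in\mathbb{S}_n}f^{[i_{k-1}]}(\tilde g)\prod_{l=1}^{k-2}f^{[i_l]}(\tilde g g_l)\,\rho(\tilde g).$$ The (Multi-Orbit) $k$-Spectrum of $f$ is the collection of its entries $$\hat{\mathcal S}^{(k)}_f(G_{k-2},\rho)=\bigoplus_{I_k=(i_1,\dots,i_k)\in\{1,\dots,d\}^k}\hat r^{(k)}_{I_{k-1}}(G_{k-2},\rho)^\dagger\,\widehat{f^{[i_k]}}(\rho),$$ where $I_{k-1}$ is $I_k$ with its last index removed, the direct sum is a block-diagonal matrix with blocks in a fixed order, and $\dagger$ is conjugate transpose. *)

theory Defs
  imports
    "HOL-Algebra.Sym_Groups"
    "Jordan_Normal_Form.VS_Connect"
    "Jordan_Normal_Form.Schur_Decomposition"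
begin

definition partitions_of :: "nat \<Rightarrow> nat list set" where
  "partitions_of n =
     {\<mu>. sorted_wrt (\<ge>) \<mu> \<and> (\<forall>p\<in>set \<mu>. 0 < p) \<and> sum_list \<mu> = n}"

text \<open>A tableau is the list of its rows, so \<open>T ! r ! c\<close> is the entry in row \<open>r\<close> and
  column \<open>c\<close>, both counted from 0.\<close>

definition standard_tableaux :: "nat list \<Rightarrow> nat list list set" where
  "standard_tableaux \<mu> =
     {T. map length T = \<mu> \<and> distinct (concat T) \<and> set (concat T) = {1..sum_list \<mu>} \<and>
         (\<forall>r<length T. sorted_wrt (<) (T ! r)) \<and>
         (\<forall>r c. Suc r < length T \<and> c < length (T ! Suc r) \<longrightarrow> T ! r ! c < T ! Suc r ! c)}"

definition entry_content :: "nat list list \<Rightarrow> nat \<Rightarrow> int" where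
  "entry_content T a =
     (THE z. \<exists>r c. r < length T \<and> c < length (T ! r) \<and> T ! r ! c = a \<and> z = int c - int r)"

definition axial_distance :: "nat list list \<Rightarrow> nat \<Rightarrow> nat \<Rightarrow> int" where
  "axial_distance T a b = entry_content T b - entry_content T a"

definition act_tableau :: "(nat \<Rightarrow> nat) \<Rightarrow> nat list list \<Rightarrow> nat list list" where
  "act_tableau \<sigma> T = map (map \<sigma>) T"

text \<open>Young's orthogonal matrix of the adjacent transposition \<open>s = (i, i + 1)\<close> in the basis \<open>ts\<close> of
  standard tableaux: \<open>s\<close> sends \<open>T\<close> to \<open>(1/\<delta>) T + sqrt (1 - 1/\<delta>\<^sup>2) (s T)\<close>, where \<open>\<delta>\<close> is the axial
  distance from \<open>i\<close> to \<open>i + 1\<close> in \<open>T\<close>.  If \<open>s T\<close> is not standard then \<open>\<delta>\<close> is \<open>1\<close> or \<open>-1\<close>, and the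
  second term vanishes.\<close>

definition young_orthogonal_matrix :: "nat list list list \<Rightarrow> nat \<Rightarrow> complex mat" where
  "young_orthogonal_matrix ts i =
     mat (length ts) (length ts) (\<lambda>(a, b).
       let T = ts ! b; \<delta> = real_of_int (axial_distance T i (Suc i)) in
       if ts ! a = T then complex_of_real (1 / \<delta>)
       else if ts ! a = act_tableau (Transposition.transpose i (Suc i)) T
         then complex_of_real (sqrt (1 - 1 / \<delta>\<^sup>2))
       else 0)"

definition matrix_rep :: "nat \<Rightarrow> nat \<Rightarrow> ((nat \<Rightarrow> nat) \<Rightarrow> complex mat) \<Rightarrow> bool" where
  "matrix_rep n m \<rho> \<longleftrightarrow> \<rho> \<in> hom (sym_group n) (units_of (ring_mat TYPE(complex) m ()))"

definition irreducible_rep :: "nat \<Rightarrow> nat \<Rightarrow> ((nat \<Rightarrow> nat) \<Rightarrow> complex mat) \<Rightarrow> bool" where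
  "irreducible_rep n m \<rho> \<longleftrightarrow> matrix_rep n m \<rho> \<and> 0 < m \<and>
     (\<forall>W. VectorSpace.subspace class_ring W (module_vec TYPE(complex) m) \<and>
          (\<forall>g\<in>carrier (sym_group n). \<forall>w\<in>W. \<rho> g *\<^sub>v w \<in> W) \<longrightarrow>
          W = {0\<^sub>v m} \<or> W = carrier_vec m)"

text \<open>The adjacent transpositions generate the symmetric group, so a representation in Young's
  orthogonal form is determined by its values on them.  Texts differ in the order they put on the
  tableau basis; every order is admitted here, hence there is one element of \<open>Irr n\<close> (up to its
  irrelevant values off the group) for each partition and each order \<open>ts\<close>.\<close>

definition young_orthogonal_form ::
    "nat \<Rightarrow> nat list \<Rightarrow> nat list list list \<Rightarrow> ((nat \<Rightarrow> nat) \<Rightarrow> complex mat) \<Rightarrow> bool" where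
  "young_orthogonal_form n \<mu> ts \<rho> \<longleftrightarrow>
     distinct ts \<and> set ts = standard_tableaux \<mu> \<and> matrix_rep n (length ts) \<rho> \<and>
     (\<forall>i\<in>{1..<n}. \<rho> (Transposition.transpose i (Suc i)) = young_orthogonal_matrix ts i)"

definition Irr :: "nat \<Rightarrow> ((nat \<Rightarrow> nat) \<Rightarrow> complex mat) set" where
  "Irr n = {\<rho>. \<exists>\<mu>\<in>partitions_of n. \<exists>ts.
      young_orthogonal_form n \<mu> ts \<rho> \<and> irreducible_rep n (length ts) \<rho>}"

definition rep_degree :: "((nat \<Rightarrow> nat) \<Rightarrow> complex mat) \<Rightarrow> nat" where
  "rep_degree \<rho> = dim_row (\<rho> id)"

text \<open>The sum of matrices is taken entrywise.\<close>

definition fourier ::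
    "nat \<Rightarrow> ((nat \<Rightarrow> nat) \<Rightarrow> complex) \<Rightarrow> ((nat \<Rightarrow> nat) \<Rightarrow> complex mat) \<Rightarrow> complex mat" where
  "fourier n \<phi> \<rho> =
     mat (rep_degree \<rho>) (rep_degree \<rho>) (\<lambda>(a, b).
       1 / of_nat (Coset.order (sym_group n)) * (\<Sum>g\<in>carrier (sym_group n). \<phi> g * \<rho> g $$ (a, b)))"

text \<open>Vectors and lists are indexed from 0: the scalar components of \<open>f\<close> are \<open>\<lambda>g. f g $ i\<close> for
  \<open>i < d\<close>, the list \<open>I = [i\<^sub>1, \<dots>, i\<^sub>k\<^sub>-\<^sub>1]\<close> has entries below \<open>d\<close>, and \<open>G = [g\<^sub>1, \<dots>, g\<^sub>k\<^sub>-\<^sub>2]\<close>.\<close>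

definition r_hat ::
    "nat \<Rightarrow> nat \<Rightarrow> ((nat \<Rightarrow> nat) \<Rightarrow> complex vec) \<Rightarrow> nat list \<Rightarrow> (nat \<Rightarrow> nat) list \<Rightarrow>
      ((nat \<Rightarrow> nat) \<Rightarrow> complex mat) \<Rightarrow> complex mat" where
  "r_hat n k f I G \<rho> =
     fourier n (\<lambda>g. f g $ (I ! (k - 2)) * (\<Prod>l<k - 2. f (g \<otimes>\<^bsub>sym_group n\<^esub> G ! l) $ (I ! l))) \<rho>"

text \<open>The blocks are ordered lexicographically by their index \<open>(i\<^sub>1, \<dots>, i\<^sub>k)\<close>.\<close>

definition k_spectrum ::
    "nat \<Rightarrow> nat \<Rightarrow> nat \<Rightarrow> ((nat \<Rightarrow> nat) \<Rightarrow> complex vec) \<Rightarrow> (nat \<Rightarrow> nat) list \<Rightarrow>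
      ((nat \<Rightarrow> nat) \<Rightarrow> complex mat) \<Rightarrow> complex mat" where
  "k_spectrum n d k f G \<rho> =
     diag_block_mat
       (map (\<lambda>I. mat_adjoint (r_hat n k f (butlast I) G \<rho>) * fourier n (\<lambda>g. f g $ last I) \<rho>)
         (product_lists (replicate k [0..<d])))"

end

theory Submission
  imports Defs
begin

text \<open>Left translation of \<open>\<phi>\<close> by \<open>\<sigma>\<^sub>0\<close> multiplies its Fourier transform at \<open>\<rho>\<close> from the left by the
  matrix \<open>U = \<rho> (\<sigma>\<^sub>0\<^sup>-\<^sup>1)\<close>.  Right translations by the entries of \<open>G\<close> commute with left ones, so both
  factors of each block of the spectrum pick up \<open>U\<close>, and \<open>(U A)\<^sup>\<dagger> (U B) = A\<^sup>\<dagger> B\<close> as soon as \<open>U\<close> is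
  unitary.  Young's orthogonal matrices of the adjacent transpositions are real symmetric, and they are
  involutions because \<open>\<rho>\<close> is a homomorphism; hence they are unitary, and so is every value of \<open>\<rho>\<close>.\<close>

section \<open>Adjoints of complex matrices\<close>

lemma dim_mat_adjoint [simp]:
  "dim_row (mat_adjoint A) = dim_col A" "dim_col (mat_adjoint A) = dim_row A"
  by (simp_all add: mat_adjoint_def)

lemma mat_adjoint_carrier:
  "A \<in> carrier_mat nr nc \<Longrightarrow> mat_adjoint A \<in> carrier_mat nc nr"
  by (metis carrier_matD carrier_matI dim_mat_adjoint)

lemma index_mat_adjoint:
  "i < dim_col A \<Longrightarrow> j < dim_row A \<Longrightarrow> mat_adjoint A $$ (i, j) = conjugate (A $$ (j, i))"
  by (simp add: mat_adjoint_def mat_of_rows_index)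

lemma mat_adjoint_mult:
  fixes A B :: "complex mat"
  assumes "A \<in> carrier_mat n m" "B \<in> carrier_mat m l"
  shows "mat_adjoint (A * B) = mat_adjoint B * mat_adjoint A"
proof (rule eq_matI)
  fix i j
  assume "i < dim_row (mat_adjoint B * mat_adjoint A)" "j < dim_col (mat_adjoint B * mat_adjoint A)"
  then have "i < l" "j < n" using assms by simp_all
  then show "mat_adjoint (A * B) $$ (i, j) = (mat_adjoint B * mat_adjoint A) $$ (i, j)"
    using assms
    by (simp add: index_mat_adjoint scalar_prod_def conjugate_complex_def mult.commute)
qed (use assms in simp_all)

text \<open>Regrouping produces the inner factor \<open>mat_adjoint U * U\<close>, which is the
  identity. This serves twice: for the blocks of the spectrum, and for the closure of unitary
  matrices under products.\<close>

lemma mat_adjoint_mult_cancel: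
  fixes A B U :: "complex mat"
  assumes U: "U \<in> carrier_mat m m" and unit: "mat_adjoint U * U = 1\<^sub>m m"
    and A: "A \<in> carrier_mat m p" and B: "B \<in> carrier_mat m q"
  shows "mat_adjoint (U * A) * (U * B) = mat_adjoint A * B"
proof -
  note U' = mat_adjoint_carrier[OF U] and A' = mat_adjoint_carrier[OF A]
  have "mat_adjoint (U * A) * (U * B) = mat_adjoint A * mat_adjoint U * (U * B)"
    by (simp add: mat_adjoint_mult[OF U A])
  also have "\<dots> = mat_adjoint A * (mat_adjoint U * (U * B))"
    by (rule assoc_mult_mat[OF A' U' mult_carrier_mat[OF U B]])
  also have "mat_adjoint U * (U * B) = mat_adjoint U * U * B"
    by (rule assoc_mult_mat[OF U' U B, symmetric])
  finally show ?thesis using B by (simp add: unit)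
qed

section \<open>Generation of the symmetric group by adjacent transpositions\<close>

text \<open>Permutations are products of transpositions, and every transposition arises from
  adjacent ones by repeated conjugation. The rule carries a property from the generators, where
  Young's form prescribes the matrices, to the whole group.\<close>

lemma permutes_adjacent_induct [consumes 1, case_names id adjacent comp]:
  assumes p: "p permutes {1..n}"
    and id: "P id"
    and adj: "\<And>i. i \<in> {1..<n} \<Longrightarrow> P (Transposition.transpose i (Suc i))"
    and comp: "\<And>p q. P p \<Longrightarrow> P q \<Longrightarrow> P (p \<circ> q)"
  shows "P p"
proof -
  have less: "1 \<le> a \<Longrightarrow> a < b \<Longrightarrow> b \<le> n \<Longrightarrow> P (Transposition.transpose a b)" for a b
  proof (induction b)
    case (Suc b)
    show ?case
    proof (cases "a = b")
      case True
      with Suc.prems adj show ?thesis by simp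
    next
      case False
      have s: "P (Transposition.transpose b (Suc b))"
        using Suc.prems False by (intro adj) auto
      have t: "P (Transposition.transpose a b)"
        using Suc False by simp
      \<comment> \<open>Conjugation by (b, b + 1) moves b to b + 1 and fixes a, since a < b.\<close>
      have "Transposition.transpose a (Suc b) =
          Transposition.transpose b (Suc b) \<circ> Transposition.transpose a b \<circ> Transposition.transpose b (Suc b)"
        using Suc.prems False by (auto simp: fun_eq_iff Transposition.transpose_def)
      then show ?thesis using comp[OF comp[OF s t] s] by (simp only:)
    qed
  qed simp
  have transp: "P (Transposition.transpose a b)" if "a \<in> {1..n}" "b \<in> {1..n}" "a \<noteq> b" for a b
    using less[of a b] less[of b a] that by (cases "a < b") (auto simp: transpose_commute)
  show ?thesis
    using p finite_atLeastAtMost id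
  proof (induction rule: permutes_induct)
    case (swap a b p)
    then show ?case using comp[OF transp[of a b], of p] by blast
  qed
qed

section \<open>Symmetry of Young's orthogonal matrices\<close>

text \<open>As b is the only preimage of a, the cells of a in the image tableau are exactly the
  cells of b in \<open>T\<close>. Both \<open>THE\<close> descriptions thus have the same predicate,
  and their values agree even where it has no unique solution.\<close>

lemma entry_content_act:
  assumes "\<And>x. \<sigma> x = a \<longleftrightarrow> x = b"
  shows "entry_content (act_tableau \<sigma> T) a = entry_content T b"
proof -
  have "(\<exists>r c. r < length (act_tableau \<sigma> T) \<and> c < length (act_tableau \<sigma> T ! r) \<and>
          act_tableau \<sigma> T ! r ! c = a \<and> z = int c - int r) \<longleftrightarrow>
        (\<exists>r c. r < length T \<and> c < length (T ! r) \<and> T ! r ! c = b \<and> z = int c - int r)" for z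
    by (auto simp: act_tableau_def assms cong: conj_cong)
  then show ?thesis
    unfolding entry_content_def by simp
qed

text \<open>The transposition exchanges the contents of a and b, so their difference changes
  sign.\<close>

lemma axial_distance_act_transpose:
  "axial_distance (act_tableau (Transposition.transpose a b) T) a b = - axial_distance T a b"
proof -
  have "entry_content (act_tableau (Transposition.transpose a b) T) a = entry_content T b"
    "entry_content (act_tableau (Transposition.transpose a b) T) b = entry_content T a"
    by (rule entry_content_act; auto simp: Transposition.transpose_def)+
  then show ?thesis by (simp add: axial_distance_def)
qed

lemma act_tableau_transpose_involutory:
  "act_tableau (Transposition.transpose a b) (act_tableau (Transposition.transpose a b) T) = T"
  by (simp add: act_tableau_def)

lemma index_young_orthogonal_matrix:
  assumes "a < length ts" "b < length ts"
  shows "young_orthogonal_matrix ts i $$ (a, b) =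
    (if ts ! a = ts ! b then complex_of_real (1 / real_of_int (axial_distance (ts ! b) i (Suc i)))
     else if ts ! a = act_tableau (Transposition.transpose i (Suc i)) (ts ! b)
       then complex_of_real (sqrt (1 - 1 / (real_of_int (axial_distance (ts ! b) i (Suc i)))\<^sup>2))
     else 0)"
  using assms by (simp add: young_orthogonal_matrix_def Let_def)

text \<open>All entries are real, so only symmetry is at stake. It can fail only off the diagonal,
  where the entry depends on the axial distance through its square alone.\<close>

lemma mat_adjoint_young_orthogonal_matrix:
  "mat_adjoint (young_orthogonal_matrix ts i) = young_orthogonal_matrix ts i" (is "mat_adjoint ?Y = _")
proof (rule eq_matI)
  fix a b
  assume "a < dim_row ?Y" "b < dim_col ?Y"
  then have a: "a < length ts" and b: "b < length ts"
    by (simp_all add: young_orthogonal_matrix_def)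
  let ?s = "act_tableau (Transposition.transpose i (Suc i))"
  \<comment> \<open>The action is an involution, so the square-root entries occupy positions
    symmetric about the diagonal.\<close>
  have swap: "ts ! a = ?s (ts ! b) \<longleftrightarrow> ts ! b = ?s (ts ! a)"
    using act_tableau_transpose_involutory by metis
  have "mat_adjoint ?Y $$ (a, b) = conjugate (?Y $$ (b, a))"
    using a b by (intro index_mat_adjoint) (simp_all add: young_orthogonal_matrix_def)
  also have "\<dots> = ?Y $$ (a, b)"
  proof (cases "ts ! a = ts ! b")
    case True
    then show ?thesis
      by (simp add: index_young_orthogonal_matrix[OF a b] index_young_orthogonal_matrix[OF b a])
  next
    case ne: False
    note index = index_young_orthogonal_matrix[OF a b] index_young_orthogonal_matrix[OF b a]
      if_not_P[OF ne] if_not_P[OF ne[symmetric]]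
    show ?thesis
    proof (cases "ts ! a = ?s (ts ! b)")
      case True
      have dist: "axial_distance (ts ! a) i (Suc i) = - axial_distance (ts ! b) i (Suc i)"
        by (simp only: True axial_distance_act_transpose)
      show ?thesis
        unfolding index if_P[OF True] if_P[OF True[unfolded swap]] dist by simp
    next
      case False
      show ?thesis
        unfolding index if_not_P[OF False] if_not_P[OF False[unfolded swap]] by simp
    qed
  qed
  finally show "mat_adjoint ?Y $$ (a, b) = ?Y $$ (a, b)" .
qed (simp_all add: young_orthogonal_matrix_def)

section \<open>Matrix representations and unitarity of Young's orthogonal form\<close>

lemma matrix_rep_carrier:
  assumes "matrix_rep n m \<rho>" "g \<in> carrier (sym_group n)"
  shows "\<rho> g \<in> carrier_mat m m"
  using hom_in_carrier[OF assms(1)[unfolded matrix_rep_def] assms(2)]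
  by (auto simp: units_of_carrier Units_def ring_mat_simps)

lemma matrix_rep_comp:
  assumes "matrix_rep n m \<rho>" "g \<in> carrier (sym_group n)" "h \<in> carrier (sym_group n)"
  shows "\<rho> (g \<circ> h) = \<rho> g * \<rho> h"
  using hom_mult[OF assms(1)[unfolded matrix_rep_def] assms(2,3)]
  by (simp add: sym_group_mult units_of_mult ring_mat_simps)

lemma matrix_rep_id:
  assumes "matrix_rep n m \<rho>"
  shows "\<rho> id = 1\<^sub>m m"
proof -
  interpret ring "ring_mat TYPE(complex) m ()" by (rule ring_mat)
  show ?thesis
    using hom_one[OF assms[unfolded matrix_rep_def] sym_group_is_group units_group]
    by (simp add: sym_group_one units_of_one ring_mat_simps)
qed

lemma young_orthogonal_form_unitary:
  assumes \<rho>: "young_orthogonal_form n \<mu> ts \<rho>" and g: "g \<in> carrier (sym_group n)"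
  shows "mat_adjoint (\<rho> g) * \<rho> g = 1\<^sub>m (length ts)"
proof -
  let ?m = "length ts"
  have rep: "matrix_rep n ?m \<rho>"
    using \<rho> by (simp add: young_orthogonal_form_def)
  have "g permutes {1..n}" using g by (simp add: sym_group_carrier)
  \<comment> \<open>Membership is carried through the induction because \<open>\<rho>\<close> is
    known to be multiplicative only on the group.\<close>
  then have "g \<in> carrier (sym_group n) \<and> mat_adjoint (\<rho> g) * \<rho> g = 1\<^sub>m ?m"
  proof (induction rule: permutes_adjacent_induct)
    case id
    have "mat_adjoint (1\<^sub>m ?m :: complex mat) = 1\<^sub>m ?m"
      by (intro eq_matI) (auto simp: index_mat_adjoint)
    then show ?case
      unfolding matrix_rep_id[OF rep] sym_group_carrier using permutes_id by simp
  next
    case (adjacent i)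
    let ?s = "Transposition.transpose i (Suc i)"
    have s: "?s \<in> carrier (sym_group n)"
      using adjacent by (auto simp: sym_group_carrier intro: permutes_swap_id)
    \<comment> \<open>With this, the product in question is \<open>\<rho> (?s \<circ> ?s)\<close>,
      that is, \<open>\<rho> id\<close>.\<close>
    have "mat_adjoint (\<rho> ?s) = \<rho> ?s"
      using \<rho> adjacent by (simp add: young_orthogonal_form_def mat_adjoint_young_orthogonal_matrix)
    with s matrix_rep_comp[OF rep s s] show ?case
      by (simp add: matrix_rep_id[OF rep])
  next
    case (comp p q)
    then have "p \<circ> q \<in> carrier (sym_group n)"
      by (auto simp: sym_group_carrier intro: permutes_compose)
    moreover have "mat_adjoint (\<rho> (p \<circ> q)) * \<rho> (p \<circ> q) = 1\<^sub>m ?m"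
      using comp mat_adjoint_mult_cancel[of "\<rho> p" ?m "\<rho> q" ?m "\<rho> q" ?m]
      by (simp add: matrix_rep_comp[OF rep] matrix_rep_carrier[OF rep])
    ultimately show ?case by blast
  qed
  then show ?thesis by simp
qed

section \<open>Fourier transforms of translated functions\<close>

lemma fourier_cong:
  assumes "\<And>g. g \<in> carrier (sym_group n) \<Longrightarrow> \<phi> g = \<psi> g"
  shows "fourier n \<phi> \<rho> = fourier n \<psi> \<rho>"
  using assms by (simp add: fourier_def cong: sum.cong)

lemma fourier_carrier:
  assumes "matrix_rep n m \<rho>"
  shows "fourier n \<phi> \<rho> \<in> carrier_mat m m"
  by (simp add: fourier_def rep_degree_def matrix_rep_id[OF assms])

text \<open>Substituting \<open>h\<close> for the translated argument turns \<open>\<rho> g\<close>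
  into the product of \<open>\<rho> (inv \<sigma>)\<close> and \<open>\<rho> h\<close>, whose first
  factor leaves the sum. Since the transform is defined entrywise, this is done for each matrix
  entry.\<close>

lemma fourier_translate:
  assumes rep: "matrix_rep n m \<rho>" and \<sigma>: "\<sigma> \<in> carrier (sym_group n)"
  shows "fourier n (\<lambda>g. \<phi> (\<sigma> \<otimes>\<^bsub>sym_group n\<^esub> g)) \<rho> = \<rho> (inv\<^bsub>sym_group n\<^esub> \<sigma>) * fourier n \<phi> \<rho>"
proof -
  interpret group "sym_group n" by (rule sym_group_is_group)
  let ?C = "carrier (sym_group n)" and ?\<tau> = "inv\<^bsub>sym_group n\<^esub> \<sigma>"
  have \<tau>: "?\<tau> \<in> ?C" using \<sigma> by (rule inv_closed)
  have deg: "rep_degree \<rho> = m"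
    by (simp add: rep_degree_def matrix_rep_id[OF rep])
  note car = matrix_rep_carrier[OF rep]
  have entry: "(\<Sum>g\<in>?C. \<phi> (\<sigma> \<otimes>\<^bsub>sym_group n\<^esub> g) * \<rho> g $$ (a, b)) =
      (\<Sum>c<m. \<rho> ?\<tau> $$ (a, c) * (\<Sum>g\<in>?C. \<phi> g * \<rho> g $$ (c, b)))" if ab: "a < m" "b < m" for a b
  proof -
    have "(\<Sum>g\<in>?C. \<phi> (\<sigma> \<otimes>\<^bsub>sym_group n\<^esub> g) * \<rho> g $$ (a, b)) =
        (\<Sum>h\<in>?C. \<phi> h * \<rho> (?\<tau> \<otimes>\<^bsub>sym_group n\<^esub> h) $$ (a, b))"
      \<comment> \<open>Left multiplications by \<open>?\<tau>\<close> and \<open>\<sigma>\<close>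
        are mutually inverse. The inverse is kept in group form so that the group laws apply to
        it.\<close>
      by (rule sum.reindex_bij_witness[of _ "\<lambda>h. ?\<tau> \<otimes>\<^bsub>sym_group n\<^esub> h" "\<lambda>g. \<sigma> \<otimes>\<^bsub>sym_group n\<^esub> g"])
        (use \<sigma> \<tau> in \<open>simp_all add: m_assoc[symmetric] del: sym_group_inv_equality\<close>)
    also have "\<dots> = (\<Sum>h\<in>?C. \<Sum>c<m. \<rho> ?\<tau> $$ (a, c) * (\<phi> h * \<rho> h $$ (c, b)))"
    proof (rule sum.cong[OF refl])
      fix h assume h: "h \<in> ?C"
      show "\<phi> h * \<rho> (?\<tau> \<otimes>\<^bsub>sym_group n\<^esub> h) $$ (a, b) =
          (\<Sum>c<m. \<rho> ?\<tau> $$ (a, c) * (\<phi> h * \<rho> h $$ (c, b)))"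
        using car[OF \<tau>] car[OF h] ab
        by (simp add: sym_group_mult matrix_rep_comp[OF rep \<tau> h] scalar_prod_def sum_distrib_left
            atLeast0LessThan mult_ac del: sym_group_inv_equality)
    qed
    also have "\<dots> = (\<Sum>c<m. \<rho> ?\<tau> $$ (a, c) * (\<Sum>g\<in>?C. \<phi> g * \<rho> g $$ (c, b)))"
      by (subst sum.swap) (simp add: sum_distrib_left)
    finally show ?thesis .
  qed
  show ?thesis
    using car[OF \<tau>]
    by (intro eq_matI)
      (simp_all add: fourier_def deg entry scalar_prod_def sum_divide_distrib[symmetric] atLeast0LessThan
        del: sym_group_inv_equality)
qed

theorem theorem4p3:
  fixes n d k :: nat
    and f\<^sub>1 f\<^sub>2 :: "(nat \<Rightarrow> nat) \<Rightarrow> complex vec"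
    and \<sigma>\<^sub>0 :: "nat \<Rightarrow> nat"
  assumes "n \<ge> 1" and "d \<ge> 1" and "k \<ge> 2"
    and "f\<^sub>1 \<in> carrier (sym_group n) \<rightarrow> carrier_vec d"
    and "f\<^sub>2 \<in> carrier (sym_group n) \<rightarrow> carrier_vec d"
    and "\<sigma>\<^sub>0 \<in> carrier (sym_group n)"
    and "\<And>\<sigma>. \<sigma> \<in> carrier (sym_group n) \<Longrightarrow> f\<^sub>1 \<sigma> = f\<^sub>2 (\<sigma>\<^sub>0 \<otimes>\<^bsub>sym_group n\<^esub> \<sigma>)"
  shows "\<forall>G \<rho>. length G = k - 2 \<and> set G \<subseteq> carrier (sym_group n) \<and> \<rho> \<in> Irr n \<longrightarrow>
           k_spectrum n d k f\<^sub>1 G \<rho> = k_spectrum n d k f\<^sub>2 G \<rho>"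
proof (intro allI impI, elim conjE)
  fix G \<rho>
  assume len: "length G = k - 2" and G: "set G \<subseteq> carrier (sym_group n)" and "\<rho> \<in> Irr n"
  then obtain \<mu> ts where \<rho>: "young_orthogonal_form n \<mu> ts \<rho>"
    by (auto simp: Irr_def)
  then have rep: "matrix_rep n (length ts) \<rho>"
    by (simp add: young_orthogonal_form_def)
  interpret group "sym_group n" by (rule sym_group_is_group)
  define U where "U = \<rho> (inv\<^bsub>sym_group n\<^esub> \<sigma>\<^sub>0)"
  have \<tau>: "inv\<^bsub>sym_group n\<^esub> \<sigma>\<^sub>0 \<in> carrier (sym_group n)"
    using assms(6) by (rule inv_closed)
  have U: "U \<in> carrier_mat (length ts) (length ts)" "mat_adjoint U * U = 1\<^sub>m (length ts)"
    unfolding U_def using matrix_rep_carrier[OF rep \<tau>] young_orthogonal_form_unitary[OF \<rho> \<tau>] .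
  \<comment> \<open>Read backwards, the translation law absorbs \<open>U\<close> into the argument,
    which leaves a pointwise identity on the group.\<close>
  have fourier: "fourier n (\<lambda>g. f\<^sub>1 g $ i) \<rho> = U * fourier n (\<lambda>g. f\<^sub>2 g $ i) \<rho>" for i
    unfolding U_def fourier_translate[OF rep assms(6), symmetric]
    by (rule fourier_cong) (simp add: assms(7))
  have r_hat: "r_hat n k f\<^sub>1 I G \<rho> = U * r_hat n k f\<^sub>2 I G \<rho>" for I
    unfolding U_def r_hat_def fourier_translate[OF rep assms(6), symmetric]
  proof (rule fourier_cong)
    fix g assume g: "g \<in> carrier (sym_group n)"
    \<comment> \<open>Both the relation between the two functions and associativity are available
      only for group elements. Associativity lets the left factor \<open>\<sigma>\<^sub>0\<close>
      pass the right factor \<open>G ! l\<close>.\<close>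
    have Gl: "G ! l \<in> carrier (sym_group n)" if "l < k - 2" for l
      using that len G by (metis nth_mem subsetD)
    show "f\<^sub>1 g $ (I ! (k - 2)) * (\<Prod>l<k - 2. f\<^sub>1 (g \<otimes>\<^bsub>sym_group n\<^esub> G ! l) $ (I ! l)) =
        f\<^sub>2 (\<sigma>\<^sub>0 \<otimes>\<^bsub>sym_group n\<^esub> g) $ (I ! (k - 2)) *
        (\<Prod>l<k - 2. f\<^sub>2 (\<sigma>\<^sub>0 \<otimes>\<^bsub>sym_group n\<^esub> g \<otimes>\<^bsub>sym_group n\<^esub> G ! l) $ (I ! l))"
      using g Gl assms(6) by (simp add: assms(7) m_assoc)
  qed
  have "mat_adjoint (r_hat n k f\<^sub>1 (butlast I) G \<rho>) * fourier n (\<lambda>g. f\<^sub>1 g $ last I) \<rho> =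
      mat_adjoint (r_hat n k f\<^sub>2 (butlast I) G \<rho>) * fourier n (\<lambda>g. f\<^sub>2 g $ last I) \<rho>" for I
    unfolding fourier r_hat
    by (rule mat_adjoint_mult_cancel[OF U]) (auto simp: r_hat_def intro: fourier_carrier[OF rep])
  then show "k_spectrum n d k f\<^sub>1 G \<rho> = k_spectrum n d k f\<^sub>2 G \<rho>"
    by (simp add: k_spectrum_def)
qed

end
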